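(* Let $p\ge 3$ and $q\ge 3$ be integers, $t=(p-1)q$, $G=(V,E)$ a simple undirected graph in which every vertex has degree at least $1$ and at most $t+1$, and $w:E\to\mathbb{R}_{\ge 0}$ a weight function vertex-induced on every $K^p_q$ of $G$. Let $G'=(V',E')$, $w'$, $l$, $b$ be as constructed below. Then (i) for any $K^p_q$-covering co-$t$-matching $\bar M$ of $G$ there exists an $(l,b)$-matching $M'$ of $G'$ with $w'(M')=w(\bar M)$; and (ii) for any $(l,b)$-matching $M'$ of $G'$ there exists a $K^p_q$-covering co-$t$-matching $\bar M$ of $G$ with $w(\bar M)\le w'(M')$.
   Context: $K^p_q$ denotes the complete $p$-partite graph with $p$ color classes of $q$ vertices each; a "$K^p_q$ of $G$" is a subgraph of $G$ (not necessarily induced) isomorphic to it, with color classes $V_1(H),\dots,V_p(H)$. $w$ is vertex-induced on a subgraph $H$ if there is $r_H:V(H)\to\mathbb{R}$ (a potential function) with $w(u,v)=r_H(u)+r_H(v)$ for every edge $(u,v)$ of $H$; $w(H)$ is the total weight of the edges of $H$. A set $\bar M\subseteq E$ is a co-$t$-matching if $E\setminus\bar M$ is a $t$-matching (every vertex incident to at most $t$ of its edges); it is $K^p_q$-covering if moreover $E\setminus\bar M$ contains the edge set of no $K^p_q$ of $G$. A $K^p_q$ $H$ of $G$ is unproblematic if there is another $K^p_q$ $H'\ne H$ of $G$ sharing a vertex with $H$ and with $w(H)\le w(H')$; otherwise it is problematic (problematic ones are pairwise vertex-disjoint). Construction: start with $G'=G$, $w'(e)=w(e)$ for $e\in E$;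 each vertex $v$ of $G$ gets capacity interval $[l(v),b(v)]=[1,t+1]$ if $\deg_G(v)=t+1$ and $[0,\deg_G(v)]$ otherwise. For each problematic $K^p_q$ $H$ of $G$ with a fixed potential function $r_H$, add new vertices $u^1_H,\dots,u^p_H$ (capacity interval $[1,1]$) and $z_H$ (capacity interval $[p-2,p-2]$); for each $i$ add an edge $(v,u^i_H)$ of weight $r_H(v)$ for every $v\in V_i(H)$, and an edge $(u^i_H,z_H)$ of weight $0$. An $(l,b)$-matching of $G'$ is a set $M'\subseteq E'$ with $l(v)\le\deg_{M'}(v)\le b(v)$ for all $v\in V'$; $w'(M')$ is its total weight. *)

theory Defs
  imports Complex_Main
begin

type_synonym 'a graph = "'a set \<times> 'a set set"

abbreviation verts :: "'a graph \<Rightarrow> 'a set" where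
  "verts G \<equiv> fst G"

abbreviation edges :: "'a graph \<Rightarrow> 'a set set" where
  "edges G \<equiv> snd G"

definition simple_graph :: "'a graph \<Rightarrow> bool" where
  "simple_graph G \<longleftrightarrow> finite (verts G) \<and> (\<forall>e\<in>edges G. e \<subseteq> verts G \<and> card e = 2)"

definition subgraph :: "'a graph \<Rightarrow> 'a graph \<Rightarrow> bool" where
  "subgraph H G \<longleftrightarrow> simple_graph H \<and> verts H \<subseteq> verts G \<and> edges H \<subseteq> edges G"

definition graph_iso :: "('a \<Rightarrow> 'b) \<Rightarrow> 'a graph \<Rightarrow> 'b graph \<Rightarrow> bool" where
  "graph_iso \<phi> G H \<longleftrightarrow> bij_betw \<phi> (verts G) (verts H) \<and> edges H = (\<lambda>e. \<phi> ` e) ` edges G"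

definition degree :: "'a set set \<Rightarrow> 'a \<Rightarrow> nat" where
  "degree F v = card {e \<in> F. v \<in> e}"

definition Kpq :: "nat \<Rightarrow> nat \<Rightarrow> (nat \<times> nat) graph" where
  "Kpq p q = ({1..p} \<times> {1..q},
     {{(i, a), (j, b)} | i a j b.
        i \<in> {1..p} \<and> j \<in> {1..p} \<and> i \<noteq> j \<and> a \<in> {1..q} \<and> b \<in> {1..q}})"

definition is_Kpq_of :: "nat \<Rightarrow> nat \<Rightarrow> 'a graph \<Rightarrow> 'a graph \<Rightarrow> bool" where
  "is_Kpq_of p q G H \<longleftrightarrow> subgraph H G \<and> (\<exists>\<phi>. graph_iso \<phi> (Kpq p q) H)"

text \<open>The subgraph \<open>H\<close> determines its color classes only up to their order, so
  \<open>color_classes p q H C\<close> says that \<open>C 1, \<dots>, C p\<close> is one admissible numbering.\<close>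

definition color_classes :: "nat \<Rightarrow> nat \<Rightarrow> 'a graph \<Rightarrow> (nat \<Rightarrow> 'a set) \<Rightarrow> bool" where
  "color_classes p q H C \<longleftrightarrow>
     (\<exists>\<phi>. graph_iso \<phi> (Kpq p q) H \<and> (\<forall>i\<in>{1..p}. C i = \<phi> ` ({i} \<times> {1..q})))"

definition weight :: "('a set \<Rightarrow> real) \<Rightarrow> 'a set set \<Rightarrow> real" where
  "weight w F = (\<Sum>e\<in>F. w e)"

definition is_potential :: "('a set \<Rightarrow> real) \<Rightarrow> 'a graph \<Rightarrow> ('a \<Rightarrow> real) \<Rightarrow> bool" where
  "is_potential w H r \<longleftrightarrow> (\<forall>u v. {u, v} \<in> edges H \<longrightarrow> w {u, v} = r u + r v)"

definition vertex_induced_on :: "('a set \<Rightarrow> real) \<Rightarrow> 'a graph \<Rightarrow> bool" where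
  "vertex_induced_on w H \<longleftrightarrow> (\<exists>r. is_potential w H r)"

definition t_matching :: "nat \<Rightarrow> 'a graph \<Rightarrow> 'a set set \<Rightarrow> bool" where
  "t_matching t G M \<longleftrightarrow> M \<subseteq> edges G \<and> (\<forall>v\<in>verts G. degree M v \<le> t)"

definition co_t_matching :: "nat \<Rightarrow> 'a graph \<Rightarrow> 'a set set \<Rightarrow> bool" where
  "co_t_matching t G M \<longleftrightarrow> M \<subseteq> edges G \<and> t_matching t G (edges G - M)"

definition Kpq_covering :: "nat \<Rightarrow> nat \<Rightarrow> 'a graph \<Rightarrow> 'a set set \<Rightarrow> bool" where
  "Kpq_covering p q G M \<longleftrightarrow> \<not> (\<exists>H. is_Kpq_of p q G H \<and> edges H \<subseteq> edges G - M)"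

definition unproblematic ::
  "nat \<Rightarrow> nat \<Rightarrow> 'a graph \<Rightarrow> ('a set \<Rightarrow> real) \<Rightarrow> 'a graph \<Rightarrow> bool" where
  "unproblematic p q G w H \<longleftrightarrow> is_Kpq_of p q G H \<and>
     (\<exists>H'. is_Kpq_of p q G H' \<and> H' \<noteq> H \<and> verts H \<inter> verts H' \<noteq> {} \<and>
           weight w (edges H) \<le> weight w (edges H'))"

definition problematic ::
  "nat \<Rightarrow> nat \<Rightarrow> 'a graph \<Rightarrow> ('a set \<Rightarrow> real) \<Rightarrow> 'a graph \<Rightarrow> bool" where
  "problematic p q G w H \<longleftrightarrow> is_Kpq_of p q G H \<and> \<not> unproblematic p q G w H"

text \<open>Vertices of the auxiliary graph: \<open>Orig v\<close> is the vertex \<open>v\<close> of the given graph,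
  \<open>U H i\<close> is \<open>u\<^sup>i\<^sub>H\<close> and \<open>Z H\<close> is \<open>z\<^sub>H\<close>.\<close>

datatype 'a aux_vertex = Orig 'a | U "'a graph" nat | Z "'a graph"

definition aux_graph ::
  "nat \<Rightarrow> nat \<Rightarrow> 'a graph \<Rightarrow> ('a set \<Rightarrow> real) \<Rightarrow> ('a graph \<Rightarrow> nat \<Rightarrow> 'a set) \<Rightarrow>
   'a aux_vertex graph" where
  "aux_graph p q G w C =
     (Orig ` verts G
        \<union> {U H i | H i. problematic p q G w H \<and> i \<in> {1..p}}
        \<union> {Z H | H. problematic p q G w H},
      (\<lambda>e. Orig ` e) ` edges G
        \<union> {{Orig v, U H i} | v H i. problematic p q G w H \<and> i \<in> {1..p} \<and> v \<in> C H i}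
        \<union> {{U H i, Z H} | H i. problematic p q G w H \<and> i \<in> {1..p}})"

text \<open>The index set of the sum has one element for an edge \<open>{Orig v, U H i}\<close> and none for
  an edge \<open>{U H i, Z H}\<close>; see the three equations below.\<close>

definition aux_weight ::
  "('a set \<Rightarrow> real) \<Rightarrow> ('a graph \<Rightarrow> 'a \<Rightarrow> real) \<Rightarrow> 'a aux_vertex set \<Rightarrow> real" where
  "aux_weight w r e =
     (if e \<subseteq> range Orig then w (Orig -` e)
      else (\<Sum>(v, H) \<in> {(v, H). \<exists>i. e = {Orig v, U H i}}. r H v))"

lemma aux_weight_Orig: "aux_weight w r (Orig ` e) = w e"
proof -
  have "Orig -` (Orig ` e) = e" by auto
  moreover have "Orig ` e \<subseteq> range Orig" by auto
  ultimately show ?thesis by (simp add: aux_weight_def)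
qed

lemma aux_weight_U: "aux_weight w r {Orig v, U H i} = r H v"
proof -
  have "{(v', H'). \<exists>i'. {Orig v, U H i} = {Orig v', U H' i'}} = {(v, H)}"
    by (auto simp: doubleton_eq_iff)
  moreover have "\<not> {Orig v, U H i} \<subseteq> range Orig" by auto
  ultimately show ?thesis by (simp add: aux_weight_def)
qed

lemma aux_weight_Z: "aux_weight w r {U H i, Z H} = 0"
proof -
  have "{(v', H'). \<exists>i'. {U H i, Z H} = {Orig v', U H' i'}} = {}"
    by (auto simp: doubleton_eq_iff)
  moreover have "\<not> {U H i, Z H} \<subseteq> range Orig" by auto
  ultimately show ?thesis by (simp only: aux_weight_def if_False sum.empty)
qed

primrec lower_cap :: "nat \<Rightarrow> nat \<Rightarrow> 'a graph \<Rightarrow> 'a aux_vertex \<Rightarrow> nat" where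
  "lower_cap p t G (Orig v) = (if degree (edges G) v = t + 1 then 1 else 0)"
| "lower_cap p t G (U H i) = 1"
| "lower_cap p t G (Z H) = p - 2"

primrec upper_cap :: "nat \<Rightarrow> nat \<Rightarrow> 'a graph \<Rightarrow> 'a aux_vertex \<Rightarrow> nat" where
  "upper_cap p t G (Orig v) =
     (if degree (edges G) v = t + 1 then t + 1 else degree (edges G) v)"
| "upper_cap p t G (U H i) = 1"
| "upper_cap p t G (Z H) = p - 2"

definition lb_matching ::
  "('a \<Rightarrow> nat) \<Rightarrow> ('a \<Rightarrow> nat) \<Rightarrow> 'a graph \<Rightarrow> 'a set set \<Rightarrow> bool" where
  "lb_matching l b G M \<longleftrightarrow>
     M \<subseteq> edges G \<and> (\<forall>v\<in>verts G. l v \<le> degree M v \<and> degree M v \<le> b v)"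

end

theory Submission
  imports Defs
begin

text \<open>An edge \<open>{u, v}\<close> of a problematic \<open>H\<close>, with \<open>u\<close> in class \<open>i\<close> and \<open>v\<close> in class \<open>j\<close>, is
  traded for the edges from \<open>u\<close> to \<open>u\<^sup>i\<^sub>H\<close> and from \<open>v\<close> to \<open>u\<^sup>j\<^sub>H\<close>, the other \<open>u\<^sup>k\<^sub>H\<close> being joined to \<open>z\<^sub>H\<close>;
  the potential makes this weight-preserving. Every \<open>(l, b)\<close>-matching consists of
  original edges and exactly one such gadget per problematic \<open>H\<close>, so only the uncovered
  unproblematic subgraphs remain. The degree bound forces two distinct meeting \<open>K\<^sup>p\<^sub>q\<close>'s
  \<open>H\<close>, \<open>H'\<close> to differ in a single vertex: \<open>H'\<close> arises from \<open>H\<close> by replacing \<open>x\<close> with \<open>u\<close>, and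
  \<open>u\<close> has in \<open>H'\<close> the neighbours of \<open>x\<close> in \<open>H\<close>. If a co-\<open>t\<close>-matching \<open>M\<close> misses \<open>H\<close>, it contains all
  these edges at \<open>u\<close>; when \<open>w(H) \<le> w(H')\<close>, averaging yields a common neighbour \<open>b\<close> such that
  exchanging \<open>{u, b}\<close> for \<open>{x, b}\<close> does not increase the weight. The exchange covers \<open>H\<close> and
  uncovers nothing, so iterating it terminates.\<close>

text \<open>Graphs are pairs; without this, quantifiers over graphs would be split by the simplifier.\<close>

declare split_paired_All [simp del] split_paired_Ex [simp del]

section \<open>Neighbourhoods, degrees and edge weights\<close>

definition nbr :: "'a set set \<Rightarrow> 'a \<Rightarrow> 'a set" where
  "nbr F v = {u. {v, u} \<in> F}"

lemma nbr_iff: "u \<in> nbr F v \<longleftrightarrow> {v, u} \<in> F"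
  by (simp add: nbr_def)

lemma nbr_sym: "u \<in> nbr F v \<longleftrightarrow> v \<in> nbr F u"
  by (simp add: nbr_def insert_commute)

lemma nbr_mono: "F \<subseteq> F' \<Longrightarrow> nbr F v \<subseteq> nbr F' v"
  by (auto simp: nbr_def)

lemma doubleton_other:
  assumes "card e = 2" "v \<in> e"
  obtains u where "e = {v, u}" "u \<noteq> v"
  using assms unfolding card_2_iff by (metis insert_commute insertE singletonD)

lemma degree_eq_card_nbr:
  assumes "\<forall>e\<in>F. card e = 2"
  shows "degree F v = card (nbr F v)"
proof -
  have "{e \<in> F. v \<in> e} = (\<lambda>u. {v, u}) ` nbr F v"
    using assms by (auto simp: nbr_def elim!: doubleton_other)
  moreover have "inj_on (\<lambda>u. {v, u}) (nbr F v)"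
    by (auto simp: inj_on_def doubleton_eq_iff)
  ultimately show ?thesis
    by (simp add: degree_def card_image)
qed

lemma degree_Diff:
  assumes "finite E" "M \<subseteq> E"
  shows "degree (E - M) v + degree M v = degree E v"
proof -
  have "{e \<in> E. v \<in> e} = {e \<in> E - M. v \<in> e} \<union> {e \<in> M. v \<in> e}"
    using assms by auto
  moreover have "finite {e \<in> E - M. v \<in> e}" "finite {e \<in> M. v \<in> e}"
    using assms(1) finite_subset[OF assms(2,1)] by auto
  ultimately show ?thesis
    unfolding degree_def by (simp add: card_Un_disjoint disjoint_iff)
qed

lemma degree_pos_iff:
  assumes "finite M"
  shows "1 \<le> degree M v \<longleftrightarrow> (\<exists>e\<in>M. v \<in> e)"
  using assms by (auto simp: degree_def Suc_le_eq card_gt_0_iff)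

text \<open>The edges at \<open>x\<close> are indexed by their other ends. Applied to
  \<open>H\<close> at \<open>x\<close> and to \<open>H'\<close> at \<open>u\<close>, this isolates
  the two stars whose weights the exchange compares.\<close>

lemma weight_split_vertex:
  assumes "finite F" "\<forall>e\<in>F. card e = 2"
  shows "weight w F = weight w {e \<in> F. x \<notin> e} + (\<Sum>b\<in>nbr F x. w {x, b})"
proof -
  have star: "{e \<in> F. x \<in> e} = (\<lambda>b. {x, b}) ` nbr F x"
    using assms(2) by (auto simp: nbr_def elim!: doubleton_other)
  have "F = {e \<in> F. x \<notin> e} \<union> {e \<in> F. x \<in> e}" by auto
  then have "weight w F = weight w {e \<in> F. x \<notin> e} + weight w {e \<in> F. x \<in> e}"
    unfolding weight_def using assms(1)
    by (subst sum.union_disjoint[symmetric]) auto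
  also have "weight w {e \<in> F. x \<in> e} = (\<Sum>b\<in>nbr F x. w {x, b})"
    unfolding weight_def star by (subst sum.reindex) (auto simp: inj_on_def doubleton_eq_iff)
  finally show ?thesis .
qed

lemma simple_graph_finite_edges: "simple_graph G \<Longrightarrow> finite (edges G)"
  by (rule finite_subset[of _ "Pow (verts G)"]) (auto simp: simple_graph_def)

lemma simple_graph_nbr:
  assumes "simple_graph G"
  shows "nbr (edges G) v \<subseteq> verts G - {v}"
  using assms by (force simp: nbr_def simple_graph_def)

section \<open>Edges and colour classes of \<open>K^p_q\<close>\<close>

lemma Kpq_edge_iff:
  "{(i, a), (j, b)} \<in> edges (Kpq p q) \<longleftrightarrow>
     i \<in> {1..p} \<and> j \<in> {1..p} \<and> i \<noteq> j \<and> a \<in> {1..q} \<and> b \<in> {1..q}"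
  unfolding Kpq_def by (auto simp: doubleton_eq_iff)

text \<open>Edges of \<open>H\<close> are given as images, so the absence of edges inside a class
  rests on injectivity of \<open>\<phi>\<close>: no other pair of vertices has the same
  image.\<close>

lemma Kpq_iso_edge_iff:
  assumes iso: "graph_iso \<phi> (Kpq p q) H"
    and ia: "i \<in> {1..p}" "a \<in> {1..q}" and jb: "j \<in> {1..p}" "b \<in> {1..q}"
  shows "{\<phi> (i, a), \<phi> (j, b)} \<in> edges H \<longleftrightarrow> i \<noteq> j"
proof
  have inj: "inj_on \<phi> ({1..p} \<times> {1..q})"
    using iso by (simp add: graph_iso_def Kpq_def bij_betw_def)
  assume "{\<phi> (i, a), \<phi> (j, b)} \<in> edges H"
  then obtain e where e: "e \<in> edges (Kpq p q)" "\<phi> ` e = \<phi> ` {(i, a), (j, b)}"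
    using iso by (auto simp: graph_iso_def)
  have "e \<subseteq> {1..p} \<times> {1..q}"
    using e(1) by (auto simp: Kpq_def)
  then have "e = {(i, a), (j, b)}"
    using inj_on_image_eq_iff[OF inj, of e "{(i, a), (j, b)}"] e(2) ia jb by auto
  with e(1) show "i \<noteq> j" by (simp add: Kpq_edge_iff)
next
  assume "i \<noteq> j"
  then have "\<phi> ` {(i, a), (j, b)} \<in> edges H"
    using ia jb iso unfolding graph_iso_def by (metis Kpq_edge_iff imageI)
  then show "{\<phi> (i, a), \<phi> (j, b)} \<in> edges H" by simp
qed

lemma Kpq_iso_verts:
  assumes "graph_iso \<phi> (Kpq p q) H"
  shows "verts H = \<phi> ` ({1..p} \<times> {1..q})" "inj_on \<phi> ({1..p} \<times> {1..q})"
  using assms by (auto simp: graph_iso_def Kpq_def bij_betw_def)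

text \<open>Admissible numberings enter the later arguments only through these facts, so the
  isomorphism behind them can be forgotten.\<close>

lemma color_classes_facts:
  assumes "color_classes p q H C"
  shows color_classes_adj:
      "\<And>i j u v. i \<in> {1..p} \<Longrightarrow> j \<in> {1..p} \<Longrightarrow> i \<noteq> j \<Longrightarrow> u \<in> C i \<Longrightarrow> v \<in> C j \<Longrightarrow> {u, v} \<in> edges H"
    and color_classes_verts: "\<And>i. i \<in> {1..p} \<Longrightarrow> C i \<subseteq> verts H"
    and color_classes_edge:
      "\<And>e. e \<in> edges H \<Longrightarrow> \<exists>i j u v. i \<in> {1..p} \<and> j \<in> {1..p} \<and> i \<noteq> j \<and> u \<in> C i \<and> v \<in> C j \<and> e = {u, v}"
proof -
  obtain \<phi> where iso: "graph_iso \<phi> (Kpq p q) H"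
    and C: "\<And>i. i \<in> {1..p} \<Longrightarrow> C i = \<phi> ` ({i} \<times> {1..q})"
    using assms by (auto simp: color_classes_def)
  show "{u, v} \<in> edges H" if "i \<in> {1..p}" "j \<in> {1..p}" "i \<noteq> j" "u \<in> C i" "v \<in> C j" for i j u v
    using that C Kpq_iso_edge_iff[OF iso] by auto
  show "C i \<subseteq> verts H" if "i \<in> {1..p}" for i
    using that C Kpq_iso_verts[OF iso] by auto
  show "\<exists>i j u v. i \<in> {1..p} \<and> j \<in> {1..p} \<and> i \<noteq> j \<and> u \<in> C i \<and> v \<in> C j \<and> e = {u, v}"
    if e: "e \<in> edges H" for e
  proof -
    obtain i a j b where "e = \<phi> ` {(i, a), (j, b)}"
      and "i \<in> {1..p}" "j \<in> {1..p}" "i \<noteq> j" "a \<in> {1..q}" "b \<in> {1..q}"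
      using e iso by (auto simp: graph_iso_def Kpq_def)
    then have "\<phi> (i, a) \<in> C i" "\<phi> (j, b) \<in> C j" "e = {\<phi> (i, a), \<phi> (j, b)}"
      by (auto simp: C)
    then show ?thesis
      using \<open>i \<in> {1..p}\<close> \<open>j \<in> {1..p}\<close> \<open>i \<noteq> j\<close> by blast
  qed
qed

section \<open>Copies of \<open>K^p_q\<close> in a graph of maximum degree at most
  \<open>t + 1\<close>\<close>

locale Kpq_bounded_degree =
  fixes p q t :: nat and G :: "'a graph"
  assumes p: "p \<ge> 3" and q: "q \<ge> 3" and t: "t = (p - 1) * q"
    and simple: "simple_graph G"
    and degree_le: "\<And>v. v \<in> verts G \<Longrightarrow> degree (edges G) v \<le> t + 1"
begin

abbreviation K :: "'a graph \<Rightarrow> bool" where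
  "K \<equiv> is_Kpq_of p q G"

lemma t_ge: "t \<ge> 2 * q" "t \<ge> 6"
proof -
  show "t \<ge> 2 * q" unfolding t using p by (intro mult_right_mono) auto
  with q show "t \<ge> 6" by simp
qed

lemma edge_card: "e \<in> edges G \<Longrightarrow> card e = 2"
  and finite_verts: "finite (verts G)"
  using simple by (auto simp: simple_graph_def)

lemma finite_edges: "finite (edges G)"
  using simple by (rule simple_graph_finite_edges)

lemma finite_nbr: "finite (nbr (edges G) v)"
  using simple_graph_nbr[OF simple] finite_verts by (meson Diff_subset finite_subset)

lemma card_nbr_le:
  assumes "v \<in> verts G"
  shows "card (nbr (edges G) v) \<le> t + 1"
  using degree_le[OF assms] degree_eq_card_nbr[of "edges G" v] edge_card by simp

lemma K_subgraph:
  assumes "K H"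
  shows K_verts: "verts H \<subseteq> verts G" and K_edges: "edges H \<subseteq> edges G"
    and K_simple: "simple_graph H"
  using assms by (auto simp: is_Kpq_of_def subgraph_def)

lemma K_nbr:
  assumes "K H"
  shows K_nbr_verts: "nbr (edges H) v \<subseteq> verts H - {v}"
    and K_nbr_subset: "nbr (edges H) v \<subseteq> nbr (edges G) v"
  using simple_graph_nbr[OF K_simple[OF assms]] nbr_mono[OF K_edges[OF assms]] by auto

text \<open>The neighbours of a vertex form all the other classes. Hence vertices of
  \<open>H\<close> are non-adjacent exactly when they share a class, and the class of
  \<open>v\<close> can be written as \<open>verts H - nbr (edges H) v\<close> without choosing an
  isomorphism.\<close>

lemma K_structure:
  assumes "K H"
  shows K_card_verts: "card (verts H) = p * q"
    and K_card_nbr: "\<And>v. v \<in> verts H \<Longrightarrow> card (nbr (edges H) v) = t"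
    and K_nbr_eq: "\<And>u v. u \<in> verts H \<Longrightarrow> v \<in> verts H \<Longrightarrow> u \<notin> nbr (edges H) v \<Longrightarrow>
      nbr (edges H) u = nbr (edges H) v"
proof -
  obtain \<phi> where iso: "graph_iso \<phi> (Kpq p q) H"
    using assms by (auto simp: is_Kpq_of_def)
  note V = Kpq_iso_verts[OF iso]
  have N: "nbr (edges H) (\<phi> (i, a)) = \<phi> ` (({1..p} - {i}) \<times> {1..q})"
    if ia: "i \<in> {1..p}" "a \<in> {1..q}" for i a
  proof -
    have "nbr (edges H) (\<phi> (i, a)) \<subseteq> \<phi> ` ({1..p} \<times> {1..q})"
      using K_nbr_verts[OF assms] V(1) by blast
    moreover have "\<phi> (j, b) \<in> nbr (edges H) (\<phi> (i, a)) \<longleftrightarrow> i \<noteq> j"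
      if "j \<in> {1..p}" "b \<in> {1..q}" for j b
      using Kpq_iso_edge_iff[OF iso ia that] by (simp add: nbr_iff)
    ultimately show ?thesis by (auto simp del: atLeastAtMost_iff)
  qed
  show "card (verts H) = p * q"
    using V by (simp add: card_image)
  show "card (nbr (edges H) v) = t" if v: "v \<in> verts H" for v
  proof -
    obtain i a where ia: "i \<in> {1..p}" "a \<in> {1..q}" "v = \<phi> (i, a)"
      using v V(1) by auto
    have "inj_on \<phi> (({1..p} - {i}) \<times> {1..q})"
      by (rule inj_on_subset[OF V(2)]) auto
    then show ?thesis
      using N[OF ia(1,2)] ia by (simp add: card_image t)
  qed
  show "nbr (edges H) u = nbr (edges H) v"
    if u: "u \<in> verts H" and v: "v \<in> verts H" and uv: "u \<notin> nbr (edges H) v" for u v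
  proof -
    obtain i a where ia: "i \<in> {1..p}" "a \<in> {1..q}" "v = \<phi> (i, a)"
      using v V(1) by auto
    obtain j b where jb: "j \<in> {1..p}" "b \<in> {1..q}" "u = \<phi> (j, b)"
      using u V(1) by auto
    have "i = j"
      using uv Kpq_iso_edge_iff[OF iso ia(1,2) jb(1,2)] ia jb by (simp add: nbr_iff)
    then show ?thesis using N ia jb by simp
  qed
qed

lemma K_finite_verts: "K H \<Longrightarrow> finite (verts H)"
  using K_verts finite_verts finite_subset by blast

lemma K_card_class:
  assumes "K H" "v \<in> verts H"
  shows "card (verts H - nbr (edges H) v) = q"
proof -
  have "card (verts H - nbr (edges H) v) = p * q - t"
    using K_nbr_verts[OF assms(1), of v] K_finite_verts[OF assms(1)]
      K_card_verts[OF assms(1)] K_card_nbr[OF assms]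
    by (subst card_Diff_subset) (auto intro: finite_subset)
  also have "p * q - t = q"
    unfolding t using p by (simp add: diff_mult_distrib)
  finally show ?thesis .
qed

section \<open>Two copies of \<open>K^p_q\<close> that meet\<close>

lemma K_finite_nbr: "K H \<Longrightarrow> finite (nbr (edges H) v)"
  using finite_subset[OF K_nbr_subset finite_nbr] .

text \<open>Two extra neighbours on top of the \<open>t\<close> neighbours in \<open>H\<close> would
  give degree at least \<open>t + 2\<close>.\<close>

lemma K_extra_unique:
  assumes "K H" "v \<in> verts H"
    and "a \<in> nbr (edges G) v" "b \<in> nbr (edges G) v"
    and "a \<notin> nbr (edges H) v" "b \<notin> nbr (edges H) v"
  shows "a = b"
proof (rule ccontr)
  assume "a \<noteq> b"
  have "v \<in> verts G"
    using K_verts[OF assms(1)] assms(2) by (rule subsetD)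
  have "insert a (insert b (nbr (edges H) v)) \<subseteq> nbr (edges G) v"
    by (intro insert_subsetI K_nbr_subset assms)
  then have "card (insert a (insert b (nbr (edges H) v))) \<le> card (nbr (edges G) v)"
    by (intro card_mono finite_nbr)
  also have "card (insert a (insert b (nbr (edges H) v))) = t + 2"
    using \<open>a \<noteq> b\<close> assms(5,6) K_finite_nbr[OF assms(1)] K_card_nbr[OF assms(1,2)] by simp
  finally show False
    using card_nbr_le[OF \<open>v \<in> verts G\<close>] by linarith
qed

text \<open>Both neighbourhoods have \<open>t\<close> elements, and by \<open>K_extra_unique\<close>
  at most one neighbour of \<open>v\<close> in \<open>H'\<close> is not a neighbour in
  \<open>H\<close>. Sets of equal size then differ by a single swap.\<close>

lemma K_nbr_differ:
  assumes H: "K H" and H': "K H'" and v: "v \<in> verts H" "v \<in> verts H'"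
    and differ: "nbr (edges H) v \<noteq> nbr (edges H') v"
  obtains x u where "x \<in> nbr (edges H) v" "u \<in> nbr (edges H') v" "u \<notin> nbr (edges H) v"
    "nbr (edges H') v = insert u (nbr (edges H) v - {x})" "x \<noteq> u"
proof -
  let ?A = "nbr (edges H) v" and ?B = "nbr (edges H') v"
  have fin: "finite ?A" "finite ?B"
    using K_finite_nbr H H' by auto
  have cards: "card ?A = t" "card ?B = t"
    using K_card_nbr H H' v by auto
  have "\<not> ?B \<subseteq> ?A"
    using differ cards fin by (metis card_subset_eq)
  then obtain u where u: "u \<in> ?B" "u \<notin> ?A" by auto
  have B: "z \<in> ?A" if "z \<in> ?B" "z \<noteq> u" for z
  proof (rule ccontr)
    assume "z \<notin> ?A"
    moreover have "z \<in> nbr (edges G) v" "u \<in> nbr (edges G) v"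
      using that u K_nbr_subset[OF H', of v] by auto
    ultimately show False
      using K_extra_unique[OF H v(1)] u that by blast
  qed
  have "?B - {u} \<subseteq> ?A"
    using B by auto
  then have "card (?A - (?B - {u})) = 1"
    using fin cards u t_ge by (subst card_Diff_subset) auto
  then obtain x where x: "?A - (?B - {u}) = {x}"
    by (meson card_1_singletonE)
  have Beq: "?B = insert u (?A - {x})" and xA: "x \<in> ?A"
    using x B u by auto
  show thesis
    by (rule that[OF xA u Beq]) (use xA u in auto)
qed

text \<open>By the degree bound a vertex of \<open>H\<close> has at most one edge of \<open>G\<close> outside \<open>H\<close>; most
  contradictions below exhibit a vertex with two.\<close>

lemma K_extra_outside:
  assumes H: "K H" and H': "K H'" and v: "v \<in> verts H" "v \<in> verts H'"
    and u: "u \<in> nbr (edges H') v" "u \<notin> nbr (edges H) v"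
  shows "u \<notin> verts H"
proof
  assume uV: "u \<in> verts H"
  let ?N = "nbr (edges H)" and ?N' = "nbr (edges H')"
  obtain x u' where x: "x \<in> ?N v" "?N' v = insert u' (?N v - {x})"
    using K_nbr_differ[OF H H' v] u by metis
  with u have Nv: "?N' v = insert u (?N v - {x})" by auto
  have uV': "u \<in> verts H'" "u \<noteq> v"
    using K_nbr_verts[OF H', of v] u by auto
  have vu: "v \<in> nbr (edges G) u" "v \<notin> ?N u"
    using u K_nbr_subset[OF H', of v] by (auto simp: nbr_sym[of v])
  have u_extra: "z = v" if "z \<in> ?N' u" "z \<notin> ?N u" for z
    using K_extra_unique[OF H uV, of z v] that vu K_nbr_subset[OF H', of u] by blast
  \<comment> \<open>The vertex \<open>v\<close> already is the one extra neighbour of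
    \<open>u\<close>. A further member \<open>s\<close> of the class of \<open>v\<close> in
    \<open>H'\<close> is adjacent to \<open>u\<close> in \<open>H'\<close>; if it lies in
    \<open>verts H\<close> and is not \<open>x\<close>, it is in the class of \<open>u\<close> in
    \<open>H\<close>, hence a second extra neighbour.\<close>
  have class_sub: "verts H' - ?N' v \<subseteq> {v, x} \<union> - verts H"
  proof
    fix s assume s: "s \<in> verts H' - ?N' v"
    show "s \<in> {v, x} \<union> - verts H"
    proof (rule ccontr)
      assume "s \<notin> {v, x} \<union> - verts H"
      then have sV: "s \<noteq> v" "s \<noteq> x" "s \<in> verts H" by auto
      have "?N' s = ?N' v"
        using K_nbr_eq[OF H' _ v(2), of s] s by auto
      then have su: "s \<in> ?N' u"
        using u by (simp add: nbr_sym[of s])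
      have "s \<notin> ?N v"
        using s sV Nv by auto
      moreover have "?N u = ?N v"
        by (rule K_nbr_eq[OF H uV v(1) u(2)])
      ultimately show False
        using u_extra[OF su] sV by auto
    qed
  qed
  \<comment> \<open>Here \<open>q \<ge> 3\<close> is essential: the class of \<open>v\<close> in
    \<open>H'\<close> has a third member, which must lie outside \<open>verts H\<close> and so is a
    second extra neighbour of \<open>u\<close>.\<close>
  have "\<not> verts H' - ?N' v \<subseteq> {v, x}"
  proof
    assume "verts H' - ?N' v \<subseteq> {v, x}"
    then have "card (verts H' - ?N' v) \<le> card {v, x}"
      by (intro card_mono) auto
    also have "card {v, x} \<le> 2"
      by (simp add: card_insert_if)
    finally show False
      using K_card_class[OF H' v(2)] q by linarith
  qed
  then obtain s where s: "s \<in> verts H'" "s \<notin> ?N' v" "s \<notin> verts H"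
    using class_sub by blast
  have "?N' s = ?N' v"
    by (rule K_nbr_eq[OF H' s(1) v(2) s(2)])
  then have "s \<in> ?N' u"
    using u by (simp add: nbr_sym[of s])
  then show False
    using u_extra[of s] s v K_nbr_verts[OF H, of u] by blast
qed

text \<open>At a common vertex \<open>v\<close> with different neighbourhoods,
  \<open>K_nbr_differ\<close> supplies \<open>x\<close> and \<open>u\<close>. The class of
  \<open>v\<close> in \<open>H'\<close> brings in no further new vertex and does not contain
  \<open>x\<close>, so this swap is the whole difference of the vertex sets.\<close>

lemma K_exchange:
  assumes H: "K H" and H': "K H'" and neq: "H \<noteq> H'" and meet: "verts H \<inter> verts H' \<noteq> {}"
  obtains x u where "x \<in> verts H" "u \<notin> verts H" "u \<in> verts H'" "x \<notin> verts H'"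
    "nbr (edges H') u = nbr (edges H) x"
    "{e \<in> edges H'. u \<notin> e} \<subseteq> {e \<in> edges H. x \<notin> e}"
proof -
  let ?V = "verts H" and ?V' = "verts H'"
  let ?N = "nbr (edges H)" and ?N' = "nbr (edges H')"
  have edge_nbr: "F \<subseteq> F'"
    if "\<forall>e\<in>F. card e = 2" "\<And>a. nbr F a \<subseteq> nbr F' a" for F F' :: "'a set set"
  proof
    fix e assume "e \<in> F"
    with that(1) obtain a b where "e = {a, b}" by (meson card_2_iff)
    with \<open>e \<in> F\<close> that(2)[of a] show "e \<in> F'" by (auto simp: nbr_def)
  qed
  have card2: "\<forall>e\<in>edges H. card e = 2" "\<forall>e\<in>edges H'. card e = 2"
    using K_simple[OF H] K_simple[OF H'] by (auto simp: simple_graph_def)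
  \<comment> \<open>If the neighbourhoods agreed at all common vertices, those of an adjacent pair
    \<open>v\<close>, \<open>y\<close> would cover \<open>verts H\<close>, since the class of
    \<open>v\<close> consists of neighbours of \<open>y\<close>. The two graphs would then
    coincide.\<close>
  have "\<exists>v. v \<in> ?V \<and> v \<in> ?V' \<and> ?N v \<noteq> ?N' v"
  proof (rule ccontr)
    assume "\<nexists>v. v \<in> ?V \<and> v \<in> ?V' \<and> ?N v \<noteq> ?N' v"
    then have same: "\<And>v. v \<in> ?V \<Longrightarrow> v \<in> ?V' \<Longrightarrow> ?N v = ?N' v" by blast
    obtain v where v: "v \<in> ?V" "v \<in> ?V'" using meet by auto
    have "?N v \<noteq> {}"
      using K_card_nbr[OF H v(1)] t_ge by auto
    then obtain y where y: "y \<in> ?N v" by auto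
    have yV: "y \<in> ?V" "y \<in> ?V'"
      using y same[OF v] K_nbr_verts[OF H, of v] K_nbr_verts[OF H', of v] by auto
    have "?V \<subseteq> ?N v \<union> ?N y"
    proof
      fix z assume "z \<in> ?V"
      then show "z \<in> ?N v \<union> ?N y"
        using K_nbr_eq[OF H _ v(1), of z] y by (auto simp: nbr_sym[of z])
    qed
    also have "\<dots> \<subseteq> ?V'"
      using same v yV K_nbr_verts[OF H', of v] K_nbr_verts[OF H', of y] by auto
    finally have "?V = ?V'"
      using K_card_verts H H' K_finite_verts[OF H'] by (simp add: card_subset_eq)
    moreover have "?N v = ?N' v" for v
      using same[of v] K_nbr_verts[OF H] K_nbr_verts[OF H'] \<open>?V = ?V'\<close>
      by (metis (no_types, lifting) Diff_iff empty_iff nbr_sym subset_eq subset_antisym)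
    then have "edges H = edges H'"
      using edge_nbr card2 by (metis order_refl subset_antisym)
    ultimately show False
      using neq by (simp add: prod_eq_iff)
  qed
  then obtain v where v: "v \<in> ?V" "v \<in> ?V'" "?N v \<noteq> ?N' v" by blast
  obtain x u where x: "x \<in> ?N v" and u: "u \<in> ?N' v" "u \<notin> ?N v"
    and N'v: "?N' v = insert u (?N v - {x})" and "x \<noteq> u"
    using K_nbr_differ[OF H H' v] by metis
  have uV: "u \<notin> ?V"
    by (rule K_extra_outside[OF H H' v(1,2) u])
  have uV': "u \<in> ?V'"
    using u K_nbr_verts[OF H', of v] by auto
  \<comment> \<open>By \<open>K_extra_outside\<close>, an edge of \<open>H'\<close> with both ends
    in \<open>verts H\<close> is an edge of \<open>H\<close>.\<close>
  have inner: "b \<in> ?N a" if "a \<in> ?V" "b \<in> ?N' a" "b \<in> ?V" for a b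
    using K_extra_outside[OF H H' that(1) _ that(2)] that K_nbr_verts[OF H', of b]
    by (auto simp: nbr_sym[of b])
  \<comment> \<open>A new vertex \<open>s\<close> in the class of \<open>v\<close> would be the one
    extra neighbour of every vertex in \<open>?N v - {x}\<close>. None of these is then adjacent to
    \<open>u\<close> in \<open>H'\<close>, so \<open>t - 1\<close> vertices fall into the class of
    \<open>u\<close>, which has only \<open>q\<close>.\<close>
  have class_in: "?V' - ?N' v \<subseteq> ?V"
  proof (rule subsetI, rule ccontr)
    fix s assume s: "s \<in> ?V' - ?N' v" "s \<notin> ?V"
    have N's: "?N' s = ?N' v"
      using K_nbr_eq[OF H' _ v(2), of s] s by auto
    have "?N v - {x} \<subseteq> ?V' - ?N' u - {u}"
    proof
      fix y assume y: "y \<in> ?N v - {x}"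
      have yV: "y \<in> ?V" "y \<noteq> u"
        using y K_nbr_verts[OF H, of v] uV by auto
      have yV': "y \<in> ?V'"
        using y N'v K_nbr_verts[OF H', of v] by auto
      have "s \<in> ?N' y"
        using y N's N'v by (simp add: nbr_sym[of s])
      moreover have "s \<noteq> u" using s u by auto
      moreover have "u \<in> ?N' y \<Longrightarrow> s = u"
        using K_extra_unique[OF H yV(1), of s u] s uV K_nbr_verts[OF H, of y]
          K_nbr_subset[OF H', of y] \<open>s \<in> ?N' y\<close> by blast
      ultimately show "y \<in> ?V' - ?N' u - {u}"
        using yV yV' by (auto simp: nbr_sym[of y])
    qed
    then have "card (?N v - {x}) \<le> card (?V' - ?N' u - {u})"
      using K_finite_verts[OF H'] by (intro card_mono) auto
    also have "\<dots> \<le> card (?V' - ?N' u)"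
      using K_finite_verts[OF H'] by (intro card_mono) auto
    also have "\<dots> = q"
      by (rule K_card_class[OF H' uV'])
    finally have "t - 1 \<le> q"
      using x K_card_nbr[OF H v(1)] K_finite_nbr[OF H] by simp
    then show False
      using t_ge q by linarith
  qed
  \<comment> \<open>Otherwise \<open>x\<close> would be adjacent in \<open>H\<close> to the
    \<open>t - 1\<close> vertices of \<open>?N v - {x}\<close>, by \<open>inner\<close>, and to the
    \<open>q\<close> vertices in the class of \<open>v\<close>, exceeding \<open>t\<close>.\<close>
  have x_class: "x \<notin> ?V' - ?N' v"
  proof
    assume xW: "x \<in> ?V' - ?N' v"
    have "?N' x = ?N' v"
      using K_nbr_eq[OF H' _ v(2), of x] xW by auto
    have xV: "x \<in> ?V"
      using x K_nbr_verts[OF H, of v] by auto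
    have sub: "?N v - {x} \<subseteq> ?N x"
    proof
      fix y assume y: "y \<in> ?N v - {x}"
      then have "y \<in> ?N' x" "y \<in> ?V"
        using N'v \<open>?N' x = ?N' v\<close> K_nbr_verts[OF H, of v] by auto
      then show "y \<in> ?N x"
        using inner[OF xV] by blast
    qed
    have cls: "?V - ?N v \<subseteq> ?N x"
      using K_nbr_eq[OF H _ v(1)] x by (auto simp: nbr_sym[of _ _ x])
    have "card (?N v - {x}) + card (?V - ?N v) = card ((?N v - {x}) \<union> (?V - ?N v))"
      using K_finite_nbr[OF H] K_finite_verts[OF H] by (subst card_Un_disjoint) auto
    also have "\<dots> \<le> card (?N x)"
      using sub cls K_finite_nbr[OF H] by (intro card_mono) auto
    finally have "t - 1 + q \<le> t"
      using K_card_class[OF H v(1)] K_card_nbr[OF H v(1)] K_card_nbr[OF H xV] x K_finite_nbr[OF H]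
      by simp
    then show False using q t_ge by linarith
  qed
  have "?V' - ?N' v \<subseteq> ?V - ?N v"
    using class_in x_class N'v by auto
  then have V'_sub: "?V' \<subseteq> insert u (?V - {x})"
    using N'v x K_nbr_verts[OF H, of v] by auto
  have xV': "x \<notin> ?V'"
    using V'_sub \<open>x \<noteq> u\<close> by auto
  have xV: "x \<in> ?V"
    using x K_nbr_verts[OF H, of v] by auto
  have "card (insert u (?V - {x})) = card ?V"
    using uV xV K_finite_verts[OF H]
    by (metis DiffD1 card_Suc_Diff1 card_insert_disjoint finite_Diff)
  then have V': "?V' = insert u (?V - {x})"
    using V'_sub K_card_verts H H' K_finite_verts[OF H] by (intro card_subset_eq) auto
  \<comment> \<open>A neighbour \<open>b\<close> of \<open>x\<close> loses \<open>x\<close> in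
    \<open>H'\<close>, so it gains a neighbour outside \<open>verts H\<close>; the only such vertex
    of \<open>H'\<close> is \<open>u\<close>.\<close>
  have "?N x \<subseteq> ?N' u"
  proof
    fix b assume b: "b \<in> ?N x"
    have bV: "b \<in> ?V" "b \<in> ?V'"
      using b V' K_nbr_verts[OF H, of x] by auto
    have "x \<in> ?N b" "x \<notin> ?N' b"
      using b xV' K_nbr_verts[OF H', of b] by (auto simp: nbr_sym[of b])
    then obtain c where "c \<in> ?N' b" "c \<notin> ?N b"
      using K_nbr_differ[OF H H' bV] by metis
    then have "c \<notin> ?V" "c \<in> ?V'"
      using K_extra_outside[OF H H' bV] K_nbr_verts[OF H', of b] by auto
    then have "c = u" using V' by auto
    with \<open>c \<in> ?N' b\<close> show "b \<in> ?N' u" by (simp add: nbr_sym[of b])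
  qed
  then have N'u: "?N' u = ?N x"
    using card_subset_eq[OF K_finite_nbr[OF H']] K_card_nbr[OF H xV] K_card_nbr[OF H' uV'] by metis
  have "{e \<in> edges H'. u \<notin> e} \<subseteq> {e \<in> edges H. x \<notin> e}"
  proof (rule edge_nbr)
    fix a show "nbr {e \<in> edges H'. u \<notin> e} a \<subseteq> nbr {e \<in> edges H. x \<notin> e} a"
    proof
      fix b assume b: "b \<in> nbr {e \<in> edges H'. u \<notin> e} a"
      then have ab: "b \<in> ?N' a" "a \<in> ?N' b" "u \<noteq> a" "u \<noteq> b"
        by (auto simp: nbr_def insert_commute)
      then have "a \<in> ?V" "b \<in> ?V" "a \<noteq> x" "b \<noteq> x"
        using V' K_nbr_verts[OF H', of a] K_nbr_verts[OF H', of b] by auto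
      then show "b \<in> nbr {e \<in> edges H. x \<notin> e} a"
        using inner[of a b] ab by (auto simp: nbr_def)
    qed
  qed (use card2 in auto)
  then show thesis
    using that xV uV uV' xV' N'u by blast
qed

section \<open>Co-\<open>t\<close>-matchings and the covering of unproblematic subgraphs\<close>

lemma co_t_matching_iff:
  assumes "M \<subseteq> edges G"
  shows "co_t_matching t G M \<longleftrightarrow>
    (\<forall>v\<in>verts G. degree (edges G) v = t + 1 \<longrightarrow> (\<exists>e\<in>M. v \<in> e))"
proof -
  \<comment> \<open>As degrees are at most \<open>t + 1\<close>, the complement of \<open>M\<close>
    can exceed \<open>t\<close> only at a vertex of degree \<open>t + 1\<close> that
    \<open>M\<close> misses. The lower capacity of \<open>Orig v\<close> encodes this
    condition.\<close>
  have "degree (edges G - M) v \<le> t \<longleftrightarrow> (degree (edges G) v = t + 1 \<longrightarrow> (\<exists>e\<in>M. v \<in> e))"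
    if "v \<in> verts G" for v
    using degree_le[OF that] degree_Diff[OF finite_edges assms, of v]
      degree_pos_iff[OF finite_subset[OF assms finite_edges], of v] by linarith
  then show ?thesis
    using assms by (auto simp: co_t_matching_def t_matching_def)
qed

text \<open>The \<open>t\<close> edges of \<open>H\<close> at \<open>v\<close> already exhaust the
  bound on the complement of \<open>M\<close>.\<close>

lemma uncovered_extra_edge:
  assumes M: "co_t_matching t G M" and H: "K H" "edges H \<inter> M = {}"
    and v: "v \<in> verts H" and u: "{v, u} \<in> edges G" "{v, u} \<notin> edges H"
  shows "{v, u} \<in> M"
proof (rule ccontr)
  assume "{v, u} \<notin> M"
  have "insert u (nbr (edges H) v) \<subseteq> nbr (edges G - M) v"
    using H(2) u \<open>{v, u} \<notin> M\<close> K_edges[OF H(1)] by (auto simp: nbr_def)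
  then have "card (insert u (nbr (edges H) v)) \<le> card (nbr (edges G - M) v)"
    by (intro card_mono finite_subset[OF nbr_mono finite_nbr]) auto
  also have "\<dots> = degree (edges G - M) v"
    using edge_card by (simp add: degree_eq_card_nbr)
  also have "\<dots> \<le> t"
    using M v K_verts[OF H(1)] by (auto simp: co_t_matching_def t_matching_def)
  finally show False
    using u(2) K_finite_nbr[OF H(1)] K_card_nbr[OF H(1) v] by (simp add: nbr_iff)
qed

abbreviation uncovered :: "'a set set \<Rightarrow> 'a graph set" where
  "uncovered M \<equiv> {H. K H \<and> edges H \<inter> M = {}}"

lemma finite_K: "finite {H. K H}"
proof (rule finite_subset)
  show "{H. K H} \<subseteq> Pow (verts G) \<times> Pow (edges G)"
  proof
    fix H assume "H \<in> {H. K H}"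
    then show "H \<in> Pow (verts G) \<times> Pow (edges G)"
      by (simp add: mem_Times_iff K_verts K_edges)
  qed
qed (simp add: finite_verts finite_edges)

lemma Kpq_covering_iff: "M \<subseteq> edges G \<Longrightarrow> Kpq_covering p q G M \<longleftrightarrow> uncovered M = {}"
  using K_edges by (fastforce simp: Kpq_covering_def)

lemma cover_unproblematic:
  assumes nonneg: "\<forall>e\<in>edges G. 0 \<le> w e"
    and M: "co_t_matching t G M" and H: "unproblematic p q G w H" "edges H \<inter> M = {}"
  obtains M' where "co_t_matching t G M'" "weight w M' \<le> weight w M" "uncovered M' \<subset> uncovered M"
proof -
  obtain H' where KH: "K H" "K H'" "H \<noteq> H'" "verts H \<inter> verts H' \<noteq> {}"
    and wt: "weight w (edges H) \<le> weight w (edges H')"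
    using H(1) unfolding unproblematic_def by blast
  obtain x u where x: "x \<in> verts H" and u: "u \<notin> verts H" and "u \<in> verts H'" "x \<notin> verts H'"
    and N: "nbr (edges H') u = nbr (edges H) x"
    and rest: "{e \<in> edges H'. u \<notin> e} \<subseteq> {e \<in> edges H. x \<notin> e}"
    by (rule K_exchange[OF KH])
  let ?N = "nbr (edges H) x"
  have M_sub: "M \<subseteq> edges G" using M by (simp add: co_t_matching_def)
  have finM: "finite M" using M_sub finite_edges finite_subset by blast
  have cardN: "card ?N = t" "finite ?N"
    using K_card_nbr[OF KH(1) x(1)] K_finite_nbr[OF KH(1)] by auto
  have fin: "finite (edges H)" "finite (edges H')"
    using K_simple KH simple_graph_finite_edges by blast+
  have card2: "\<forall>e\<in>edges H. card e = 2" "\<forall>e\<in>edges H'. card e = 2"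
    using K_simple[OF KH(1)] K_simple[OF KH(2)] by (auto simp: simple_graph_def)
  \<comment> \<open>Seen from \<open>c\<close>, which belongs to \<open>H\<close>, the edge to
    \<open>u\<close> leaves \<open>H\<close>, so \<open>uncovered_extra_edge\<close> applies at
    \<open>c\<close>.\<close>
  have uM: "{u, c} \<in> M" if c: "c \<in> ?N" for c
  proof -
    have "{c, u} \<in> edges H'"
      using c N by (auto simp: nbr_def insert_commute)
    then have "{c, u} \<in> edges G" using K_edges[OF KH(2)] by blast
    moreover have "c \<in> verts H" using c K_nbr_verts[OF KH(1)] by blast
    moreover have "{c, u} \<notin> edges H"
      using u K_nbr_verts[OF KH(1), of c] by (auto simp: nbr_def)
    ultimately show ?thesis
      using uncovered_extra_edge[OF M KH(1) H(2)] by (simp add: insert_commute)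
  qed
  \<comment> \<open>Away from the two swapped vertices \<open>H'\<close> is no heavier than
    \<open>H\<close>, by nonnegativity; thus \<open>w(H) \<le> w(H')\<close> passes to the stars at
    \<open>x\<close> and \<open>u\<close>.\<close>
  have "weight w {e \<in> edges H'. u \<notin> e} \<le> weight w {e \<in> edges H. x \<notin> e}"
    unfolding weight_def
    using rest fin nonneg K_edges[OF KH(1)] by (intro sum_mono2) auto
  then have sums: "(\<Sum>b\<in>?N. w {x, b}) \<le> (\<Sum>b\<in>?N. w {u, b})"
    using wt weight_split_vertex[OF fin(1) card2(1), of w x]
      weight_split_vertex[OF fin(2) card2(2), of w u] N by simp
  obtain b where b: "b \<in> ?N" "w {x, b} \<le> w {u, b}"
  proof (rule ccontr)
    assume "\<not> thesis"
    then have "\<forall>b\<in>?N. w {u, b} < w {x, b}" using that by force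
    moreover have "?N \<noteq> {}" using cardN t_ge by auto
    ultimately have "(\<Sum>b\<in>?N. w {u, b}) < (\<Sum>b\<in>?N. w {x, b})"
      using cardN by (intro sum_strict_mono) auto
    with sums show False by simp
  qed
  define M' where "M' = insert {x, b} (M - {{u, b}})"
  have xb: "{x, b} \<in> edges H" "{x, b} \<notin> M"
    using b H(2) by (auto simp: nbr_def)
  have M'_sub: "M' \<subseteq> edges G"
    using M_sub xb K_edges[OF KH(1)] by (auto simp: M'_def)
  \<comment> \<open>A second common neighbour \<open>c\<close> keeps \<open>u\<close> incident to an
    edge of \<open>M'\<close> after \<open>{u, b}\<close> is removed.\<close>
  have "\<not> ?N \<subseteq> {b}"
  proof
    assume "?N \<subseteq> {b}"
    then have "card ?N \<le> 1"
      using card_mono[of "{b}" ?N] by simp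
    then show False using cardN t_ge by simp
  qed
  then obtain c where c: "c \<in> ?N" "c \<noteq> b" by auto
  have uM': "{u, c} \<in> M'" if "c \<in> ?N - {b}" for c
    using that uM by (auto simp: M'_def doubleton_eq_iff)
  show thesis
  proof
    show "co_t_matching t G M'"
      unfolding co_t_matching_iff[OF M'_sub]
    proof (intro ballI impI)
      fix v assume "v \<in> verts G" "degree (edges G) v = t + 1"
      then obtain e where e: "e \<in> M" "v \<in> e"
        using M co_t_matching_iff[OF M_sub] by blast
      show "\<exists>e\<in>M'. v \<in> e"
      proof (cases "e = {u, b}")
        case True
        then consider "v = u" | "v = b" using e by auto
        then show ?thesis
          using uM'[of c] c by cases (auto simp: M'_def)
      qed (use e in \<open>auto simp: M'_def\<close>)
    qed
    have "weight w M = w {u, b} + weight w (M - {{u, b}})"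
      unfolding weight_def using finM uM b by (intro sum.remove) auto
    moreover have "weight w M' = w {x, b} + weight w (M - {{u, b}})"
      unfolding weight_def M'_def using finM xb by (intro sum.insert) auto
    ultimately show "weight w M' \<le> weight w M" using b by simp
    have "H \<in> uncovered M" "H \<notin> uncovered M'"
      using KH H xb by (auto simp: M'_def)
    moreover have "uncovered M' \<subseteq> uncovered M"
    proof (intro subsetI CollectI conjI)
      fix L assume L: "L \<in> uncovered M'"
      then show KL: "K L" by simp
      show "edges L \<inter> M = {}"
      proof (rule ccontr)
        \<comment> \<open>Only the removal of \<open>{u, b}\<close> could uncover \<open>L\<close>.
          The \<open>t\<close> edges of \<open>L\<close> at \<open>u\<close> avoid
          \<open>M'\<close>, which keeps \<open>t - 1\<close> further edges at \<open>u\<close>; a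
          degree of \<open>2t - 1\<close> exceeds \<open>t + 1\<close>.\<close>
        assume "edges L \<inter> M \<noteq> {}"
        then have ub: "{u, b} \<in> edges L" using L by (auto simp: M'_def)
        then have "b \<in> nbr (edges L) u" by (simp add: nbr_iff)
        then have uL: "u \<in> verts L" 
          using K_nbr_verts[OF KL, of b] by (auto simp: nbr_sym[of b])
        have disj: "nbr (edges L) u \<inter> (?N - {b}) = {}"
          using L uM' by (auto simp: nbr_iff)
        have sub: "nbr (edges L) u \<union> (?N - {b}) \<subseteq> nbr (edges G) u"
          using K_nbr_subset[OF KL] K_nbr_subset[OF KH(2), of u] N by blast
        have "t + (t - 1) = card (nbr (edges L) u \<union> (?N - {b}))"
          using disj cardN b K_finite_nbr[OF KL] K_card_nbr[OF KL uL]
          by (subst card_Un_disjoint) auto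
        also have "\<dots> \<le> card (nbr (edges G) u)"
          using sub finite_nbr by (rule card_mono[rotated])
        also have "\<dots> \<le> t + 1"
          using card_nbr_le uL K_verts[OF KL] by blast
        finally show False using t_ge by linarith
      qed
    qed
    ultimately show "uncovered M' \<subset> uncovered M" by blast
  qed
qed

text \<open>Induction on the number of uncovered copies. Exchanges only shrink the uncovered set, so
  problematic copies stay covered and each remaining uncovered copy is unproblematic.\<close>

lemma cover_all:
  assumes nonneg: "\<forall>e\<in>edges G. 0 \<le> w e"
    and "co_t_matching t G M" "\<And>H. problematic p q G w H \<Longrightarrow> edges H \<inter> M \<noteq> {}"
  shows "\<exists>M'. co_t_matching t G M' \<and> Kpq_covering p q G M' \<and> weight w M' \<le> weight w M"
  using assms(2,3)
proof (induction "card (uncovered M)" arbitrary: M rule: less_induct)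
  case less
  have M_sub: "M \<subseteq> edges G" using less.prems(1) by (simp add: co_t_matching_def)
  show ?case
  proof (cases "uncovered M = {}")
    case True
    then show ?thesis
      using Kpq_covering_iff[OF M_sub] less.prems(1) by blast
  next
    case False
    then obtain H where H: "K H" "edges H \<inter> M = {}" by auto
    then have unp: "unproblematic p q G w H"
      using less.prems(2) unfolding problematic_def by blast
    obtain M' where M': "co_t_matching t G M'" "weight w M' \<le> weight w M"
        "uncovered M' \<subset> uncovered M"
      by (rule cover_unproblematic[OF nonneg less.prems(1) unp H(2)])
    have "card (uncovered M') < card (uncovered M)"
      using M'(3) finite_K by (intro psubset_card_mono) auto
    moreover have "edges L \<inter> M' \<noteq> {}" if "problematic p q G w L" for L
      using less.prems(2)[OF that] M'(3) that unfolding problematic_def by blast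
    ultimately obtain M'' where "co_t_matching t G M''" "Kpq_covering p q G M''"
        "weight w M'' \<le> weight w M'"
      using less.hyps M'(1) by blast
    then show ?thesis using M'(2) by (meson order_trans)
  qed
qed

end

section \<open>Gadgets and their weights\<close>

definition gadget ::
  "nat \<Rightarrow> 'a graph \<Rightarrow> nat \<Rightarrow> 'a \<Rightarrow> nat \<Rightarrow> 'a \<Rightarrow> 'a aux_vertex set set" where
  "gadget p H i u j v =
     {{Orig u, U H i}, {Orig v, U H j}} \<union> (\<lambda>k. {U H k, Z H}) ` ({1..p} - {i, j})"

lemma finite_gadget: "finite (gadget p H i u j v)"
  by (simp add: gadget_def)

text \<open>The unique \<open>U\<close>-vertex of an edge reveals its subgraph. This separates the
  gadgets of distinct subgraphs from each other and from the original edges.\<close>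

lemma gadget_tag: "e \<in> gadget p H i u j v \<Longrightarrow> \<exists>k. U H k \<in> e \<and> (\<forall>L l. U L l \<in> e \<longrightarrow> L = H \<and> l = k)"
  by (auto simp: gadget_def)

lemma weight_gadget:
  assumes "i \<noteq> j"
  shows "weight (aux_weight w r) (gadget p H i u j v) = r H u + r H v"
proof -
  let ?zs = "(\<lambda>k. {U H k, Z H}) ` ({1..p} - {i, j})"
  have "weight (aux_weight w r) (gadget p H i u j v) =
      (\<Sum>e\<in>{{Orig u, U H i}, {Orig v, U H j}}. aux_weight w r e) + (\<Sum>e\<in>?zs. aux_weight w r e)"
    unfolding weight_def gadget_def
    by (intro sum.union_disjoint) (auto simp: doubleton_eq_iff)
  also have "(\<Sum>e\<in>?zs. aux_weight w r e) = 0"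
    by (intro sum.neutral) (auto simp: aux_weight_Z)
  also have "(\<Sum>e\<in>{{Orig u, U H i}, {Orig v, U H j}}. aux_weight w r e) = r H u + r H v"
    using assms by (simp add: doubleton_eq_iff aux_weight_U)
  finally show ?thesis by simp
qed

text \<open>The common shape of the matchings in both directions. Indices and endpoints are
  functions of the subgraph, one choice per element of \<open>P\<close>.\<close>

definition aux_union ::
  "nat \<Rightarrow> 'a set set \<Rightarrow> 'a graph set \<Rightarrow> ('a graph \<Rightarrow> nat) \<Rightarrow> ('a graph \<Rightarrow> 'a) \<Rightarrow>
   ('a graph \<Rightarrow> nat) \<Rightarrow> ('a graph \<Rightarrow> 'a) \<Rightarrow> 'a aux_vertex set set" where
  "aux_union p F P i u j v =
     (\<lambda>e. Orig ` e) ` F \<union> (\<Union>H\<in>P. gadget p H (i H) (u H) (j H) (v H))"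

lemma finite_aux_union: "finite F \<Longrightarrow> finite P \<Longrightarrow> finite (aux_union p F P i u j v)"
  by (simp add: aux_union_def finite_gadget)

lemma weight_aux_union:
  assumes "finite F" "finite P" "\<And>H. H \<in> P \<Longrightarrow> i H \<noteq> j H"
  shows "weight (aux_weight w r) (aux_union p F P i u j v) =
    weight w F + (\<Sum>H\<in>P. r H (u H) + r H (v H))"
proof -
  let ?g = "\<lambda>H. gadget p H (i H) (u H) (j H) (v H)"
  have disj: "?g H \<inter> ?g L = {}" if "H \<noteq> L" for H L
  proof -
    have False if e: "e \<in> ?g H" "e \<in> ?g L" for e
      using gadget_tag[OF e(1)] gadget_tag[OF e(2)] \<open>H \<noteq> L\<close> by blast
    then show ?thesis by blast
  qed
  have "((\<lambda>e. Orig ` e) ` F) \<inter> (\<Union>H\<in>P. ?g H) = {}"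
    using gadget_tag by fastforce
  then have "weight (aux_weight w r) (aux_union p F P i u j v) =
      weight (aux_weight w r) ((\<lambda>e. Orig ` e) ` F) + weight (aux_weight w r) (\<Union>H\<in>P. ?g H)"
    unfolding weight_def aux_union_def using assms(1,2)
    by (intro sum.union_disjoint) (auto simp: finite_gadget)
  also have "weight (aux_weight w r) ((\<lambda>e. Orig ` e) ` F) = weight w F"
  proof -
    have "inj_on (\<lambda>e. Orig ` e) F"
      by (auto simp: inj_on_def inj_image_eq_iff[OF injI[of Orig]])
    then show ?thesis
      by (simp add: weight_def sum.reindex aux_weight_Orig)
  qed
  also have "weight (aux_weight w r) (\<Union>H\<in>P. ?g H) = (\<Sum>H\<in>P. weight (aux_weight w r) (?g H))"
    unfolding weight_def using assms(2) disj
    by (intro sum.UNION_disjoint) (auto simp: finite_gadget)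
  also have "\<dots> = (\<Sum>H\<in>P. r H (u H) + r H (v H))"
    using assms(3) by (intro sum.cong) (auto simp: weight_gadget)
  finally show ?thesis .
qed

section \<open>The auxiliary graph and degrees in it\<close>

locale Kpq_aux = Kpq_bounded_degree p q t G for p q t :: nat and G :: "'a graph" +
  fixes w :: "'a set \<Rightarrow> real"
    and C :: "'a graph \<Rightarrow> nat \<Rightarrow> 'a set"
    and r :: "'a graph \<Rightarrow> 'a \<Rightarrow> real"
  assumes nonneg: "\<forall>e\<in>edges G. 0 \<le> w e"
    and colors: "\<And>H. problematic p q G w H \<Longrightarrow> color_classes p q H (C H)"
    and potential: "\<And>H. problematic p q G w H \<Longrightarrow> is_potential w H (r H)"
begin

abbreviation P :: "'a graph set" where
  "P \<equiv> {H. problematic p q G w H}"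

abbreviation G' :: "'a aux_vertex graph" where
  "G' \<equiv> aux_graph p q G w C"

lemma finite_P: "finite P"
  using finite_K by (rule rev_finite_subset) (auto simp: problematic_def)

lemma P_K: "H \<in> P \<Longrightarrow> K H"
  by (simp add: problematic_def)

text \<open>If two distinct ones met, one of no greater weight than the other would be
  unproblematic.\<close>

lemma P_disjoint:
  assumes "H \<in> P" "L \<in> P" "x \<in> verts H" "x \<in> verts L"
  shows "H = L"
proof (rule ccontr)
  assume "H \<noteq> L"
  moreover have "verts H \<inter> verts L \<noteq> {}" "verts L \<inter> verts H \<noteq> {}" using assms by auto
  moreover have "weight w (edges H) \<le> weight w (edges L) \<or> weight w (edges L) \<le> weight w (edges H)"
    by linarith
  ultimately show False
    using assms(1,2) unfolding problematic_def unproblematic_def by blast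
qed

text \<open>A choice of one edge in each problematic subgraph. The classes of its ends are recorded
  too, because they determine which vertices \<open>U H k\<close> the gadget uses.\<close>

definition selection ::
  "('a graph \<Rightarrow> nat) \<Rightarrow> ('a graph \<Rightarrow> 'a) \<Rightarrow> ('a graph \<Rightarrow> nat) \<Rightarrow> ('a graph \<Rightarrow> 'a) \<Rightarrow> bool" where
  "selection i u j v \<longleftrightarrow> (\<forall>H\<in>P. i H \<in> {1..p} \<and> j H \<in> {1..p} \<and> i H \<noteq> j H \<and>
     u H \<in> C H (i H) \<and> v H \<in> C H (j H))"

lemma selection_facts:
  assumes "selection i u j v" "H \<in> P"
  shows selection_index: "i H \<in> {1..p}" "j H \<in> {1..p}" "i H \<noteq> j H"
    and selection_class: "u H \<in> C H (i H)" "v H \<in> C H (j H)"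
    and selection_edge: "{u H, v H} \<in> edges H"
    and selection_verts: "u H \<in> verts H" "v H \<in> verts H"
    and selection_neq: "u H \<noteq> v H"
    and selection_weight: "w {u H, v H} = r H (u H) + r H (v H)"
proof -
  show index: "i H \<in> {1..p}" "j H \<in> {1..p}" "i H \<noteq> j H"
    and cls: "u H \<in> C H (i H)" "v H \<in> C H (j H)"
    using assms by (auto simp: selection_def)
  have cc: "color_classes p q H (C H)" using colors assms by simp
  show edge: "{u H, v H} \<in> edges H"
    by (rule color_classes_adj[OF cc index cls])
  show "u H \<in> verts H" "v H \<in> verts H"
    using color_classes_verts[OF cc] index cls by blast+
  have "card {u H, v H} = 2"
    using edge K_edges[OF P_K[OF assms(2)]] edge_card by blast
  then show "u H \<noteq> v H" by auto
  show "w {u H, v H} = r H (u H) + r H (v H)"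
    using potential[of H] assms(2) edge by (auto simp: is_potential_def)
qed

lemma selection_edge_G:
  "selection i u j v \<Longrightarrow> H \<in> P \<Longrightarrow> {u H, v H} \<in> edges G"
  using selection_edge K_edges P_K by blast

text \<open>Problematic subgraphs are vertex-disjoint, so their chosen edges are distinct. Sums over
  chosen edges thereby become sums over \<open>P\<close>.\<close>

lemma selection_inj:
  assumes sel: "selection i u j v"
  shows "inj_on (\<lambda>H. {u H, v H}) P"
proof (rule inj_onI)
  fix H L assume HL: "H \<in> P" "L \<in> P" "{u H, v H} = {u L, v L}"
  then have "u H \<in> {u L, v L}" by auto
  then have "u H \<in> verts L" using selection_verts[OF sel HL(2)] by auto
  then show "H = L" using P_disjoint selection_verts[OF sel HL(1)] HL by blast
qed

lemma aux_edge_U: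
  assumes "e \<in> edges G'" "U H k \<in> e"
  shows "H \<in> P \<and> k \<in> {1..p} \<and> ((\<exists>s\<in>C H k. e = {Orig s, U H k}) \<or> e = {U H k, Z H})"
  using assms by (auto simp: aux_graph_def)

lemma aux_edge_Z:
  assumes "e \<in> edges G'" "Z H \<in> e"
  shows "\<exists>k\<in>{1..p}. e = {U H k, Z H}"
  using assms by (auto simp: aux_graph_def)

lemma aux_edge_cases:
  assumes "e \<in> edges G'"
  obtains f where "f \<in> edges G" "e = Orig ` f" | H k where "H \<in> P" "U H k \<in> e"
  using assms by (auto simp: aux_graph_def)

lemma aux_union_subset:
  assumes "F \<subseteq> edges G" "selection i u j v"
  shows "aux_union p F P i u j v \<subseteq> edges G'"
proof -
  have "gadget p H (i H) (u H) (j H) (v H) \<subseteq> edges G'" if "H \<in> P" for H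
  proof -
    have "{Orig (u H), U H (i H)} \<in> edges G'" "{Orig (v H), U H (j H)} \<in> edges G'"
      using that selection_index[OF assms(2) that] selection_class[OF assms(2) that]
      unfolding aux_graph_def by auto
    moreover have "{U H k, Z H} \<in> edges G'" if "k \<in> {1..p}" for k
      using that \<open>H \<in> P\<close> unfolding aux_graph_def by auto
    ultimately show ?thesis by (auto simp: gadget_def)
  qed
  moreover have "(\<lambda>e. Orig ` e) ` F \<subseteq> edges G'"
    using assms(1) by (auto simp: aux_graph_def)
  ultimately show ?thesis by (auto simp: aux_union_def)
qed

lemma degree_aux_union_U:
  assumes "selection i u j v" "H \<in> P" "k \<in> {1..p}"
  shows "degree (aux_union p F P i u j v) (U H k) = 1"
proof -
  have "{e \<in> aux_union p F P i u j v. U H k \<in> e} =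
      {if k = i H then {Orig (u H), U H k} else if k = j H then {Orig (v H), U H k} else {U H k, Z H}}"
    using assms selection_index[OF assms(1,2)] by (auto simp: aux_union_def gadget_def)
  then show ?thesis by (simp add: degree_def)
qed

lemma degree_aux_union_Z:
  assumes "selection i u j v" "H \<in> P"
  shows "degree (aux_union p F P i u j v) (Z H) = p - 2"
proof -
  have "{e \<in> aux_union p F P i u j v. Z H \<in> e} = (\<lambda>k. {U H k, Z H}) ` ({1..p} - {i H, j H})"
    using assms by (auto simp: aux_union_def gadget_def)
  moreover have "inj_on (\<lambda>k. {U H k, Z H}) ({1..p} - {i H, j H})"
    by (auto simp: inj_on_def doubleton_eq_iff)
  moreover have "card ({1..p} - {i H, j H}) = p - 2"
    using selection_index[OF assms] by (subst card_Diff_subset) auto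
  ultimately show ?thesis by (simp add: degree_def card_image)
qed

text \<open>Incidence, unlike degree, is unaffected when a chosen edge already lies in
  \<open>F\<close>; this suffices for turning matchings back into
  co-\<open>t\<close>-matchings.\<close>

lemma aux_union_Orig_iff:
  "(\<exists>e\<in>aux_union p F P i u j v. Orig x \<in> e) \<longleftrightarrow>
    (\<exists>e\<in>F \<union> (\<lambda>H. {u H, v H}) ` P. x \<in> e)"
  by (auto simp: aux_union_def gadget_def)

text \<open>By disjointness \<open>x\<close> is an end of at most one chosen edge, whose place at
  \<open>Orig x\<close> is taken by one gadget edge. A chosen edge inside \<open>F\<close> would be
  counted once on the right but twice on the left.\<close>

lemma degree_aux_union_Orig:
  assumes sel: "selection i u j v" and fin: "finite F" and F: "\<And>H. H \<in> P \<Longrightarrow> {u H, v H} \<notin> F"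
  shows "degree (aux_union p F P i u j v) (Orig x) = degree (F \<union> (\<lambda>H. {u H, v H}) ` P) x"
proof -
  let ?M' = "aux_union p F P i u j v" and ?M = "F \<union> (\<lambda>H. {u H, v H}) ` P"
  let ?Fx = "{e \<in> F. x \<in> e}"
  have card_Orig: "card ((\<lambda>e. Orig ` e) ` ?Fx) = card ?Fx"
    by (intro card_image) (auto simp: inj_on_def inj_image_eq_iff[OF injI[of Orig]])
  show ?thesis
  proof (cases "\<exists>H\<in>P. x = u H \<or> x = v H")
    case False
    then have "{e \<in> ?M'. Orig x \<in> e} = (\<lambda>e. Orig ` e) ` ?Fx" "{e \<in> ?M. x \<in> e} = ?Fx"
      by (auto simp: aux_union_def gadget_def)
    then show ?thesis by (simp add: degree_def card_Orig)
  next
    case True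
    then obtain H where H: "H \<in> P" "x = u H \<or> x = v H" by blast
    have unique: "L = H" if "L \<in> P" "x = u L \<or> x = v L" for L
      using P_disjoint[OF that(1) H(1), of x] that(2) H(2)
        selection_verts[OF sel that(1)] selection_verts[OF sel H(1)] by auto
    let ?k = "if x = u H then i H else j H"
    have "{e \<in> ?M'. Orig x \<in> e} = insert {Orig x, U H ?k} ((\<lambda>e. Orig ` e) ` ?Fx)"
    proof (intro equalityI subsetI)
      fix e assume "e \<in> {e \<in> ?M'. Orig x \<in> e}"
      then consider f where "f \<in> F" "e = Orig ` f" "x \<in> f"
        | L where "L \<in> P" "e = {Orig (u L), U L (i L)}" "x = u L"
        | L where "L \<in> P" "e = {Orig (v L), U L (j L)}" "x = v L"
        by (auto simp: aux_union_def gadget_def)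
      then show "e \<in> insert {Orig x, U H ?k} ((\<lambda>e. Orig ` e) ` ?Fx)"
      proof cases
        case 2
        then show ?thesis using unique[of L] by auto
      next
        case 3
        then show ?thesis using unique[of L] selection_neq[OF sel H(1)] by auto
      qed auto
    next
      fix e assume "e \<in> insert {Orig x, U H ?k} ((\<lambda>e. Orig ` e) ` ?Fx)"
      moreover have "{Orig x, U H ?k} \<in> gadget p H (i H) (u H) (j H) (v H)"
        using H(2) by (auto simp: gadget_def)
      ultimately show "e \<in> {e \<in> ?M'. Orig x \<in> e}"
        using H(1) unfolding aux_union_def by blast
    qed
    moreover have "{Orig x, U H ?k} \<notin> (\<lambda>e. Orig ` e) ` ?Fx" by blast
    moreover have "{e \<in> ?M. x \<in> e} = insert {u H, v H} ?Fx"
    proof (intro equalityI subsetI)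
      fix e assume "e \<in> {e \<in> ?M. x \<in> e}"
      then consider "e \<in> ?Fx" | L where "L \<in> P" "e = {u L, v L}" "x = u L \<or> x = v L"
        by blast
      then show "e \<in> insert {u H, v H} ?Fx"
        using unique by cases auto
    next
      fix e assume "e \<in> insert {u H, v H} ?Fx"
      then show "e \<in> {e \<in> ?M. x \<in> e}" using H by blast
    qed
    ultimately show ?thesis
      using fin F[OF H(1)] by (simp add: degree_def card_Orig)
  qed
qed

section \<open>From covering co-\<open>t\<close>-matchings to
  \<open>(l, b)\<close>-matchings\<close>

lemma aux_matching_of_covering:
  assumes M: "co_t_matching t G M" and cover: "Kpq_covering p q G M"
  shows "\<exists>M'. lb_matching (lower_cap p t G) (upper_cap p t G) G' M' \<and>
    weight (aux_weight w r) M' = weight w M"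
proof -
  have M_sub: "M \<subseteq> edges G" using M by (simp add: co_t_matching_def)
  have finM: "finite M" using finite_subset[OF M_sub finite_edges] .
  \<comment> \<open>A covering \<open>M\<close> contains an edge of each problematic
    \<open>H\<close>. The implication leaves the values outside \<open>P\<close> arbitrary, so that
    choice gives total functions.\<close>
  have "\<exists>i u j v. H \<in> P \<longrightarrow> i \<in> {1..p} \<and> j \<in> {1..p} \<and> i \<noteq> j \<and> u \<in> C H i \<and> v \<in> C H j \<and> {u, v} \<in> M" for H
  proof (cases "H \<in> P")
    case True
    have "\<not> edges H \<subseteq> edges G - M"
      using cover P_K[OF True] unfolding Kpq_covering_def by blast
    then obtain e where "e \<in> edges H" "e \<in> M"
      using K_edges[OF P_K[OF True]] by blast
    then show ?thesis
      using color_classes_edge[OF colors] True by (metis mem_Collect_eq)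
  qed simp
  then obtain i u j v where "\<And>H. H \<in> P \<longrightarrow> i H \<in> {1..p} \<and> j H \<in> {1..p} \<and> i H \<noteq> j H \<and>
      u H \<in> C H (i H) \<and> v H \<in> C H (j H) \<and> {u H, v H} \<in> M"
    by metis
  then have sel: "selection i u j v" and uv: "\<And>H. H \<in> P \<Longrightarrow> {u H, v H} \<in> M"
    by (auto simp: selection_def)
  let ?c = "\<lambda>H. {u H, v H}"
  \<comment> \<open>The chosen edges are removed because the gadgets replace them; \<open>M\<close>
    becomes a disjoint union and degrees are preserved.\<close>
  define F where "F = M - ?c ` P"
  have M_eq: "M = F \<union> ?c ` P" and F: "\<And>H. H \<in> P \<Longrightarrow> {u H, v H} \<notin> F"
    using uv by (auto simp: F_def)
  have finF: "finite F" and F_sub: "F \<subseteq> edges G" using finM M_sub by (auto simp: F_def)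
  let ?M' = "aux_union p F P i u j v"
  have degM: "degree ?M' (Orig x) = degree M x" for x
    using degree_aux_union_Orig[OF sel finF F] M_eq by simp
  have "lb_matching (lower_cap p t G) (upper_cap p t G) G' ?M'"
    unfolding lb_matching_def
  proof (intro conjI ballI)
    show "?M' \<subseteq> edges G'" by (rule aux_union_subset[OF F_sub sel])
    fix a assume a: "a \<in> verts G'"
    have "lower_cap p t G a \<le> degree ?M' a \<and> degree ?M' a \<le> upper_cap p t G a"
    proof (cases a)
      case (Orig x)
      then have x: "x \<in> verts G" using a by (auto simp: aux_graph_def)
      \<comment> \<open>In both cases of \<open>upper_cap\<close> the bound equals the degree of
        \<open>x\<close> in \<open>G\<close>.\<close>
      have "degree M x \<le> degree (edges G) x"
        unfolding degree_def using M_sub finite_edges by (intro card_mono) auto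
      moreover have "degree (edges G) x = t + 1 \<longrightarrow> 1 \<le> degree M x"
        using M x co_t_matching_iff[OF M_sub] degree_pos_iff[OF finM] by blast
      ultimately show ?thesis using Orig degM by simp
    next
      case (U H k)
      then have "H \<in> P" "k \<in> {1..p}" using a by (auto simp: aux_graph_def)
      then show ?thesis using U degree_aux_union_U[OF sel] by simp
    next
      case (Z H)
      then have "H \<in> P" using a by (auto simp: aux_graph_def)
      then show ?thesis using Z degree_aux_union_Z[OF sel] by simp
    qed
    then show "lower_cap p t G a \<le> degree ?M' a" "degree ?M' a \<le> upper_cap p t G a"
      by auto
  qed
  moreover have "weight (aux_weight w r) ?M' = weight w M"
  proof -
    have "weight (aux_weight w r) ?M' = weight w F + (\<Sum>H\<in>P. r H (u H) + r H (v H))"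
      using finF finite_P selection_index[OF sel] by (intro weight_aux_union) auto
    also have "(\<Sum>H\<in>P. r H (u H) + r H (v H)) = (\<Sum>H\<in>P. w (?c H))"
      using selection_weight[OF sel] by (intro sum.cong) auto
    also have "\<dots> = weight w (?c ` P)"
      unfolding weight_def using sum.reindex[OF selection_inj[OF sel], of w] by simp
    also have "weight w F + weight w (?c ` P) = weight w M"
      unfolding weight_def M_eq using finF finite_P F
      by (intro sum.union_disjoint[symmetric]) auto
    finally show ?thesis .
  qed
  ultimately show ?thesis by blast
qed

section \<open>From \<open>(l, b)\<close>-matchings to covering
  co-\<open>t\<close>-matchings\<close>

lemma lb_matching_gadget:
  assumes M': "lb_matching (lower_cap p t G) (upper_cap p t G) G' M'" and H: "H \<in> P"
  shows "\<exists>i u j v. i \<in> {1..p} \<and> j \<in> {1..p} \<and> i \<noteq> j \<and> u \<in> C H i \<and> v \<in> C H j \<and>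
    {e \<in> M'. \<exists>k. U H k \<in> e} = gadget p H i u j v"
proof -
  have M'_sub: "M' \<subseteq> edges G'" using M' by (simp add: lb_matching_def)
  \<comment> \<open>The capacity of \<open>Z H\<close> gives \<open>I\<close> exactly
    \<open>p - 2\<close> elements. The two remaining vertices \<open>U H i\<close> and
    \<open>U H j\<close> must be matched into their classes, which yields the chosen edge.\<close>
  define I where "I = {k \<in> {1..p}. {U H k, Z H} \<in> M'}"
  have "Z H \<in> verts G'" using H by (auto simp: aux_graph_def)
  then have "degree M' (Z H) = p - 2"
    using M' by (force simp: lb_matching_def)
  moreover have "{e \<in> M'. Z H \<in> e} = (\<lambda>k. {U H k, Z H}) ` I"
    using aux_edge_Z M'_sub by (fastforce simp: I_def)
  moreover have "inj_on (\<lambda>k. {U H k, Z H}) I"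
    by (auto simp: inj_on_def doubleton_eq_iff)
  ultimately have "card I = p - 2"
    by (simp add: degree_def card_image)
  then have "card ({1..p} - I) = 2"
    using p by (subst card_Diff_subset) (auto simp: I_def)
  then obtain i j where ij: "{1..p} - I = {i, j}" "i \<noteq> j"
    by (meson card_2_iff)
  have only: "\<exists>e. {e \<in> M'. U H k \<in> e} = {e}" if "k \<in> {1..p}" for k
  proof -
    have "U H k \<in> verts G'" using H that by (auto simp: aux_graph_def)
    then have "degree M' (U H k) = 1"
      using M' by (force simp: lb_matching_def)
    then show ?thesis by (simp add: degree_def card_1_singleton_iff)
  qed
  have out: "\<exists>s\<in>C H k. {e \<in> M'. U H k \<in> e} = {{Orig s, U H k}}" if k: "k \<in> {1..p} - I" for k
  proof -
    obtain e where e: "{e \<in> M'. U H k \<in> e} = {e}" using only k by blast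
    then have "e \<in> M'" "U H k \<in> e" by auto
    moreover have "e \<noteq> {U H k, Z H}" using k \<open>e \<in> M'\<close> by (auto simp: I_def)
    ultimately show ?thesis
      using e aux_edge_U[of e H k] M'_sub by auto
  qed
  \<comment> \<open>The edge to \<open>Z H\<close> uses up the capacity 1 of
    \<open>U H k\<close>.\<close>
  have inn: "{e \<in> M'. U H k \<in> e} = {{U H k, Z H}}" if k: "k \<in> I" for k
  proof -
    have "{U H k, Z H} \<in> {e \<in> M'. U H k \<in> e}" "k \<in> {1..p}" using k by (auto simp: I_def)
    then show ?thesis using only by (metis singletonD)
  qed
  have out_ij: "i \<in> {1..p} - I" "j \<in> {1..p} - I" using ij by auto
  obtain u where u: "u \<in> C H i" "{e \<in> M'. U H i \<in> e} = {{Orig u, U H i}}"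
    using out[OF out_ij(1)] by blast
  obtain v where v: "v \<in> C H j" "{e \<in> M'. U H j \<in> e} = {{Orig v, U H j}}"
    using out[OF out_ij(2)] by blast
  have "I \<subseteq> {1..p}" by (auto simp: I_def)
  then have I: "I = {1..p} - {i, j}" using ij(1) by blast
  have ijp: "i \<in> {1..p}" "j \<in> {1..p}" using ij by auto
  have "{e \<in> M'. \<exists>k. U H k \<in> e} = (\<Union>k\<in>{1..p}. {e \<in> M'. U H k \<in> e})"
    using aux_edge_U M'_sub by blast
  also have "{1..p} = insert i (insert j I)" using I ijp by auto
  also have "(\<Union>k\<in>insert i (insert j I). {e \<in> M'. U H k \<in> e}) =
      {{Orig u, U H i}} \<union> {{Orig v, U H j}} \<union> (\<Union>k\<in>I. {{U H k, Z H}})"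
    using u v inn by simp
  also have "\<dots> = gadget p H i u j v"
    unfolding gadget_def I by auto
  finally show ?thesis using ij ijp u v by blast
qed

text \<open>Every edge of \<open>G'\<close> is original or contains some \<open>U H k\<close>, so
  the gadgets found for the individual \<open>H\<close> account for all other edges of
  \<open>M'\<close>.\<close>

lemma lb_matching_aux_union:
  assumes M': "lb_matching (lower_cap p t G) (upper_cap p t G) G' M'"
  obtains i u j v where "selection i u j v"
    "M' = aux_union p {e \<in> edges G. Orig ` e \<in> M'} P i u j v"
proof -
  have M'_sub: "M' \<subseteq> edges G'" using M' by (simp add: lb_matching_def)
  define Q where "Q H i u j v \<longleftrightarrow> i \<in> {1..p} \<and> j \<in> {1..p} \<and> i \<noteq> j \<and> u \<in> C H i \<and> v \<in> C H j \<and>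
      {e \<in> M'. \<exists>k. U H k \<in> e} = gadget p H i u j v" for H i u j v
  have "\<forall>H\<in>P. \<exists>i u j v. Q H i u j v"
    unfolding Q_def by (intro ballI lb_matching_gadget[OF M'])
  then obtain i u j v where Q: "\<forall>H\<in>P. Q H (i H) (u H) (j H) (v H)"
    by metis
  then have sel: "selection i u j v" by (simp add: selection_def Q_def)
  have *: "{e \<in> M'. \<exists>k. U H k \<in> e} = gadget p H (i H) (u H) (j H) (v H)" if "H \<in> P" for H
    using Q that by (simp add: Q_def)
  have "M' = aux_union p {e \<in> edges G. Orig ` e \<in> M'} P i u j v"
  proof (intro equalityI subsetI)
    fix e assume e: "e \<in> M'"
    then have "e \<in> edges G'" using M'_sub by blast
    then show "e \<in> aux_union p {e \<in> edges G. Orig ` e \<in> M'} P i u j v"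
    proof (cases rule: aux_edge_cases)
      case (1 f)
      then show ?thesis using e by (auto simp: aux_union_def)
    next
      case (2 H k)
      then have "e \<in> gadget p H (i H) (u H) (j H) (v H)" using * e by blast
      then show ?thesis using 2 by (auto simp: aux_union_def)
    qed
  next
    fix e assume "e \<in> aux_union p {e \<in> edges G. Orig ` e \<in> M'} P i u j v"
    then show "e \<in> M'" using * unfolding aux_union_def by blast
  qed
  then show thesis using that sel by blast
qed

text \<open>Each gadget is turned back into its edge \<open>{u H, v H}\<close>. The result covers
  all problematic subgraphs, and \<open>cover_all\<close> treats the rest without increasing the
  weight.\<close>

lemma covering_of_aux_matching:
  assumes M': "lb_matching (lower_cap p t G) (upper_cap p t G) G' M'"
  shows "\<exists>M. co_t_matching t G M \<and> Kpq_covering p q G M \<and> weight w M \<le> weight (aux_weight w r) M'"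
proof -
  define F where "F = {e \<in> edges G. Orig ` e \<in> M'}"
  obtain i u j v where sel: "selection i u j v" and M'_eq: "M' = aux_union p F P i u j v"
    by (rule lb_matching_aux_union[OF M', folded F_def])
  have finF: "finite F" using finite_edges by (simp add: F_def)
  have finM': "finite M'" using finF finite_P by (simp add: M'_eq finite_aux_union)
  let ?c = "\<lambda>H. {u H, v H}"
  define M where "M = F \<union> ?c ` P"
  have c_sub: "?c ` P \<subseteq> edges G" using selection_edge_G[OF sel] by blast
  have M_sub: "M \<subseteq> edges G" using c_sub by (auto simp: M_def F_def)
  have co_t: "co_t_matching t G M"
    unfolding co_t_matching_iff[OF M_sub]
  proof (intro ballI impI)
    fix x assume x: "x \<in> verts G" "degree (edges G) x = t + 1"
    have "Orig x \<in> verts G'" using x by (auto simp: aux_graph_def)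
    then have "1 \<le> degree M' (Orig x)"
      using M' x unfolding lb_matching_def by force
    then show "\<exists>e\<in>M. x \<in> e"
      unfolding degree_pos_iff[OF finM'] unfolding M'_eq M_def aux_union_Orig_iff .
  qed
  have covered: "edges H \<inter> M \<noteq> {}" if "problematic p q G w H" for H
    using selection_edge[OF sel, of H] that unfolding M_def by blast
  obtain M0 where M0: "co_t_matching t G M0" "Kpq_covering p q G M0" "weight w M0 \<le> weight w M"
    using cover_all[OF nonneg co_t covered] by blast
  \<comment> \<open>A chosen edge may also occur in \<open>F\<close>. It then counts once in
    \<open>M\<close> but twice in \<open>M'\<close>, so nonnegative weights give an inequality
    rather than an equality.\<close>
  have "weight w M = weight w F + weight w (?c ` P - F)"
    unfolding weight_def M_def using finF finite_P
    by (subst sum.union_disjoint[symmetric]) (auto simp: Un_Diff_cancel)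
  also have "weight w (?c ` P - F) \<le> weight w (?c ` P)"
    unfolding weight_def using finite_P nonneg c_sub by (intro sum_mono2) auto
  also have "weight w (?c ` P) = (\<Sum>H\<in>P. w (?c H))"
    unfolding weight_def using sum.reindex[OF selection_inj[OF sel], of w] by simp
  also have "\<dots> = (\<Sum>H\<in>P. r H (u H) + r H (v H))"
    using selection_weight[OF sel] by (intro sum.cong) auto
  also have "weight w F + (\<Sum>H\<in>P. r H (u H) + r H (v H)) = weight (aux_weight w r) M'"
    unfolding M'_eq using finF finite_P selection_index[OF sel]
    by (intro weight_aux_union[symmetric]) auto
  finally have "weight w M \<le> weight (aux_weight w r) M'" by simp
  then show ?thesis using M0 by (meson order_trans)
qed

end

theorem theorem4:
  fixes p q t :: nat
    and G :: "'a graph"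
    and w :: "'a set \<Rightarrow> real"
    and C :: "'a graph \<Rightarrow> nat \<Rightarrow> 'a set"
    and r :: "'a graph \<Rightarrow> 'a \<Rightarrow> real"
  assumes "p \<ge> 3" and "q \<ge> 3" and "t = (p - 1) * q"
    and "simple_graph G"
    and "\<forall>v\<in>verts G. 1 \<le> degree (edges G) v \<and> degree (edges G) v \<le> t + 1"
    and "\<forall>e\<in>edges G. 0 \<le> w e"
    and "\<forall>H. is_Kpq_of p q G H \<longrightarrow> vertex_induced_on w H"
    and "\<forall>H. problematic p q G w H \<longrightarrow> color_classes p q H (C H)"
    and "\<forall>H. problematic p q G w H \<longrightarrow> is_potential w H (r H)"
  shows "(\<forall>M. co_t_matching t G M \<and> Kpq_covering p q G M \<longrightarrow>
            (\<exists>M'. lb_matching (lower_cap p t G) (upper_cap p t G) (aux_graph p q G w C) M' \<and>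
                  weight (aux_weight w r) M' = weight w M)) \<and>
         (\<forall>M'. lb_matching (lower_cap p t G) (upper_cap p t G) (aux_graph p q G w C) M' \<longrightarrow>
            (\<exists>M. co_t_matching t G M \<and> Kpq_covering p q G M \<and>
                 weight w M \<le> weight (aux_weight w r) M'))"
proof -
  interpret Kpq_aux p q t G w C r
    using assms by unfold_locales auto
  show ?thesis
    using aux_matching_of_covering covering_of_aux_matching by blast
qed

end
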